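(* A pair $(\{A_n\}_{n},\{\Psi_n\}_{n})$, with $A_n\in\mathcal{B}(\mathcal{X},\mathcal{Y})$ and $\Psi_n\in\mathcal{B}(\mathcal{Y},\mathcal{X})$ for all $n\in\mathbb{N}$, is an operator-valued p-ASF in $\mathcal{B}(\mathcal{X},\mathcal{Y})$ if and only if $$A_n=\Gamma_nU,\quad \Psi_n=VL_n,\quad\forall n\in\mathbb{N},$$ where $U:\mathcal{X}\to\ell^p(\mathbb{N})\otimes\mathcal{Y}$ and $V:\ell^p(\mathbb{N})\otimes\mathcal{Y}\to\mathcal{X}$ are bounded linear operators such that $VU$ is bounded invertible.
   Context: Banach spaces are over $\mathbb{K}=\mathbb{R}$ or $\mathbb{C}$; $\mathcal{X},\mathcal{Y}$ are Banach spaces, $p\in[1,\infty)$, $\mathcal{B}(\mathcal{X},\mathcal{Y})$ is the space of bounded linear operators. $\ell^p(\mathbb{N})\otimes\mathcal{Y}$ is the completion of the algebraic tensor product in a fixed cross norm ($\|a\otimes y\|=\|a\|\|y\|$) for which, for all $T\in\mathcal{B}(\ell^p(\mathbb{N}))$ and $R\in\mathcal{B}(\mathcal{Y})$, $T\otimes R$ extends to a bounded operator with $\|T\otimes R\|\le\|T\|\|R\|$. With $\{e_n\}_n$ the standard Schauder basis of $\ell^p(\mathbb{N})$, $L_n:\mathcal{Y}\to\ell^p(\mathbb{N})\otimes\mathcal{Y}$ is $L_ny=e_n\otimes y$, and $\Gamma_n:\ell^p(\mathbb{N})\otimes\mathcal{Y}\to\mathcal{Y}$ is the bounded linear operator with $\Gamma_n(\{a_m\}_m\otimes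 y)=a_ny$. Thus $\Gamma_nL_n=I_{\mathcal{Y}}$, $\Gamma_nL_m=0$ for $n\ne m$, and $\sum_{n=1}^\infty L_n\Gamma_nz=z$ for all $z$. For collections $\{A_n\}_{n}$ in $\mathcal{B}(\mathcal{X},\mathcal{Y})$ and $\{\Psi_n\}_{n}$ in $\mathcal{B}(\mathcal{Y},\mathcal{X})$, the pair is an operator-valued p-approximate Schauder frame (operator-valued p-ASF) in $\mathcal{B}(\mathcal{X},\mathcal{Y})$ if: (i) the frame operator $S_{A,\Psi}x=\sum_{n=1}^\infty\Psi_nA_nx$ is a well-defined bounded linear invertible operator on $\mathcal{X}$; (ii) the analysis operator $\theta_A:\mathcal{X}\to\ell^p(\mathbb{N})\otimes\mathcal{Y}$, $\theta_Ax=\sum_{n=1}^\infty L_nA_nx$, is a well-defined bounded linear operator; (iii) the synthesis operator $\theta_\Psi:\ell^p(\mathbb{N})\otimes\mathcal{Y}\to\mathcal{X}$, $\theta_\Psi z=\sum_{n=1}^\infty\Psi_n\Gamma_nz$, is a well-defined bounded linear operator. *)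

theory Defs
  imports "HOL-Analysis.Analysis"
begin

section \<open>Scalars, Banach spaces and bounded operators\<close>

text \<open>The scalar field is \<open>\<real>\<close> or \<open>\<complex>\<close>: either every scalar is real, or there is a square root
  of \<open>-1\<close> which together with \<open>1\<close> spans the field over \<open>\<real>\<close>. The norm is then the usual absolute
  value, as it is multiplicative and extends the one of \<open>\<real>\<close>.\<close>

class real_or_complex = real_normed_field +
  assumes real_or_complex:
    "(\<forall>z. \<exists>a. z = a *\<^sub>R 1) \<or> (\<exists>i. i * i = - 1 \<and> (\<forall>z. \<exists>a b. z = a *\<^sub>R 1 + b *\<^sub>R i))"

instance real :: real_or_complex
  by standard auto

instance complex :: real_or_complex
proof
  have "z = Re z *\<^sub>R 1 + Im z *\<^sub>R \<i>" for z
    by (simp add: complex_eq_iff)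
  then show "(\<forall>z::complex. \<exists>a. z = a *\<^sub>R 1)
      \<or> (\<exists>i::complex. i * i = - 1 \<and> (\<forall>z. \<exists>a b. z = a *\<^sub>R 1 + b *\<^sub>R i))"
    by (metis complex_i_mult_minus i_squared)
qed

text \<open>A Banach space over \<open>'k\<close> is a real Banach space with a compatible multiplication by scalars
  from \<open>'k\<close>.\<close>

locale banach_over = vector_space scale
  for scale :: "'k::real_or_complex \<Rightarrow> 'x::banach \<Rightarrow> 'x" +
  assumes scale_of_real: "scale (of_real r) x = r *\<^sub>R x"
    and norm_scale: "norm (scale c x) = norm c * norm x"

definition bounded_ops ::
  "('k \<Rightarrow> 'x \<Rightarrow> 'x) \<Rightarrow> ('k \<Rightarrow> 'y \<Rightarrow> 'y) \<Rightarrow> ('x::real_normed_vector \<Rightarrow> 'y::real_normed_vector) set" where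
  "bounded_ops scaleX scaleY =
     {f. bounded_linear f \<and> (\<forall>c x. f (scaleX c x) = scaleY c (f x))}"

definition bounded_invertible ::
  "('k \<Rightarrow> 'x \<Rightarrow> 'x) \<Rightarrow> ('x::real_normed_vector \<Rightarrow> 'x) \<Rightarrow> bool" where
  "bounded_invertible scaleX f \<longleftrightarrow>
     f \<in> bounded_ops scaleX scaleX \<and>
     (\<exists>g \<in> bounded_ops scaleX scaleX. g \<circ> f = id \<and> f \<circ> g = id)"

section \<open>The sequence space \<open>\<ell>\<^sup>p\<close>\<close>

text \<open>Sequences are indexed from \<open>0\<close>.\<close>

definition lp :: "real \<Rightarrow> (nat \<Rightarrow> 'k::real_normed_vector) set" where
  "lp p = {a. summable (\<lambda>n. norm (a n) powr p)}"

definition lp_norm :: "real \<Rightarrow> (nat \<Rightarrow> 'k::real_normed_vector) \<Rightarrow> real" where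
  "lp_norm p a = (\<Sum>n. norm (a n) powr p) powr (1 / p)"

definition lp_basis :: "nat \<Rightarrow> nat \<Rightarrow> 'k::zero_neq_one" where
  "lp_basis n = (\<lambda>m. if m = n then 1 else 0)"

text \<open>Operators on \<open>\<ell>\<^sup>p\<close> are functions on all sequences of which only the values on \<open>lp p\<close> matter.\<close>

definition lp_bounded_ops ::
  "real \<Rightarrow> ((nat \<Rightarrow> 'k::real_normed_field) \<Rightarrow> (nat \<Rightarrow> 'k)) set" where
  "lp_bounded_ops p =
     {T. (\<forall>a\<in>lp p. T a \<in> lp p)
       \<and> (\<forall>a\<in>lp p. \<forall>b\<in>lp p. T (\<lambda>n. a n + b n) = (\<lambda>n. T a n + T b n))
       \<and> (\<forall>c. \<forall>a\<in>lp p. T (\<lambda>n. c * a n) = (\<lambda>n. c * T a n))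
       \<and> (\<exists>C. \<forall>a\<in>lp p. lp_norm p (T a) \<le> C * lp_norm p a)}"

definition lp_onorm ::
  "real \<Rightarrow> ((nat \<Rightarrow> 'k::real_normed_field) \<Rightarrow> (nat \<Rightarrow> 'k)) \<Rightarrow> real" where
  "lp_onorm p T = (SUP a\<in>lp p. lp_norm p (T a) / lp_norm p a)"

section \<open>The completed tensor product of \<open>\<ell>\<^sup>p\<close> with a Banach space\<close>

text \<open>The algebraic tensor product \<open>\<ell>\<^sup>p \<otimes> \<Y>\<close> is the quotient of the free vector space on
  \<open>\<ell>\<^sup>p \<times> \<Y>\<close>, i.e. of the finitely supported functions from \<open>\<ell>\<^sup>p \<times> \<Y>\<close> to the scalars, by
  \<open>tensor_null\<close>, the subspace generated by the bilinearity relations.\<close>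

definition free_gen :: "'a \<Rightarrow> 'y \<Rightarrow> 'a \<times> 'y \<Rightarrow> 'k::zero_neq_one" where
  "free_gen a y = (\<lambda>q. if q = (a, y) then 1 else 0)"

inductive_set tensor_null ::
  "real \<Rightarrow> ('k \<Rightarrow> 'y \<Rightarrow> 'y) \<Rightarrow> ((nat \<Rightarrow> 'k::real_normed_field) \<times> 'y::ab_group_add \<Rightarrow> 'k) set"
  for p :: real and scaleY :: "'k \<Rightarrow> 'y \<Rightarrow> 'y"
  where
    zero: "(\<lambda>q. 0) \<in> tensor_null p scaleY"
  | add: "\<lbrakk>F \<in> tensor_null p scaleY; G \<in> tensor_null p scaleY\<rbrakk>
      \<Longrightarrow> (\<lambda>q. F q + G q) \<in> tensor_null p scaleY"
  | scale: "F \<in> tensor_null p scaleY \<Longrightarrow> (\<lambda>q. c * F q) \<in> tensor_null p scaleY"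
  | add_left: "\<lbrakk>a \<in> lp p; b \<in> lp p\<rbrakk>
      \<Longrightarrow> (\<lambda>q. free_gen (\<lambda>n. a n + b n) y q - free_gen a y q - free_gen b y q) \<in> tensor_null p scaleY"
  | add_right: "a \<in> lp p
      \<Longrightarrow> (\<lambda>q. free_gen a (y + y') q - free_gen a y q - free_gen a y' q) \<in> tensor_null p scaleY"
  | scale_left: "a \<in> lp p
      \<Longrightarrow> (\<lambda>q. free_gen (\<lambda>n. c * a n) y q - c * free_gen a y q) \<in> tensor_null p scaleY"
  | scale_right: "a \<in> lp p
      \<Longrightarrow> (\<lambda>q. free_gen a (scaleY c y) q - c * free_gen a y q) \<in> tensor_null p scaleY"

text \<open>\<open>lp_tensor scaleY scaleZ p tensor\<close>: the type \<open>'z\<close>, with the elementary tensors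
  \<open>tensor a y\<close> for \<open>a \<in> lp p\<close>, is a completion of the algebraic tensor product in a norm of the
  required kind. By bilinearity and \<open>tensor_injective\<close>, the linear extension of \<open>tensor\<close> to the free
  vector space has kernel exactly \<open>tensor_null\<close>, so it embeds the algebraic tensor product into the
  Banach space \<open>'z\<close>, with dense range. The chosen norm on the algebraic tensor product is the one
  induced from \<open>'z\<close>.\<close>

locale lp_tensor = Y: banach_over scaleY + Z: banach_over scaleZ
  for scaleY :: "'k::real_or_complex \<Rightarrow> 'y::banach \<Rightarrow> 'y"
    and scaleZ :: "'k \<Rightarrow> 'z::banach \<Rightarrow> 'z" +
  fixes p :: real
    and tensor :: "(nat \<Rightarrow> 'k) \<Rightarrow> 'y \<Rightarrow> 'z"
  assumes p_ge_1: "1 \<le> p"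
    and tensor_add_left:
      "\<lbrakk>a \<in> lp p; b \<in> lp p\<rbrakk> \<Longrightarrow> tensor (\<lambda>n. a n + b n) y = tensor a y + tensor b y"
    and tensor_add_right: "a \<in> lp p \<Longrightarrow> tensor a (y + y') = tensor a y + tensor a y'"
    and tensor_scale_left: "a \<in> lp p \<Longrightarrow> tensor (\<lambda>n. c * a n) y = scaleZ c (tensor a y)"
    and tensor_scale_right: "a \<in> lp p \<Longrightarrow> tensor a (scaleY c y) = scaleZ c (tensor a y)"
    and tensor_injective:
      "\<lbrakk>finite {q. F q \<noteq> 0}; {q. F q \<noteq> 0} \<subseteq> lp p \<times> UNIV;
        (\<Sum>(a, y)\<in>{q. F q \<noteq> 0}. scaleZ (F (a, y)) (tensor a y)) = 0\<rbrakk>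
       \<Longrightarrow> F \<in> tensor_null p scaleY"
    and tensor_dense: "closure (Z.span {tensor a y | a y. a \<in> lp p}) = UNIV"
    and cross_norm: "a \<in> lp p \<Longrightarrow> norm (tensor a y) = lp_norm p a * norm y"
    and tensor_operators:
      "\<lbrakk>T \<in> lp_bounded_ops p; R \<in> bounded_ops scaleY scaleY\<rbrakk> \<Longrightarrow>
        \<exists>W \<in> bounded_ops scaleZ scaleZ.
          (\<forall>a\<in>lp p. \<forall>y. W (tensor a y) = tensor (T a) (R y)) \<and>
          onorm W \<le> lp_onorm p T * onorm R"

definition L_op :: "((nat \<Rightarrow> 'k::zero_neq_one) \<Rightarrow> 'y \<Rightarrow> 'z) \<Rightarrow> nat \<Rightarrow> 'y \<Rightarrow> 'z" where
  "L_op tensor n y = tensor (lp_basis n) y"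

definition Gamma_op ::
  "('k \<Rightarrow> 'y \<Rightarrow> 'y) \<Rightarrow> ('k \<Rightarrow> 'z \<Rightarrow> 'z) \<Rightarrow> real \<Rightarrow> ((nat \<Rightarrow> 'k::real_normed_field) \<Rightarrow> 'y \<Rightarrow> 'z) \<Rightarrow>
   nat \<Rightarrow> 'z::real_normed_vector \<Rightarrow> 'y::real_normed_vector" where
  "Gamma_op scaleY scaleZ p tensor n =
     (THE G. G \<in> bounded_ops scaleZ scaleY \<and>
             (\<forall>a\<in>lp p. \<forall>y. G (tensor a y) = scaleY (a n) y))"

text \<open>The description defining \<open>Gamma_op\<close> is proper.\<close>

lemma bounded_ops_eqI:
  assumes Z: "banach_over scaleZ" and D: "closure (module.span scaleZ S) = UNIV"
    and f: "f \<in> bounded_ops scaleZ scaleY" and g: "g \<in> bounded_ops scaleZ scaleY"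
    and eq: "\<And>z. z \<in> S \<Longrightarrow> f z = g z"
  shows "f = g"
proof -
  interpret banach_over scaleZ by fact
  have lf: "bounded_linear f" "\<And>c x. f (scaleZ c x) = scaleY c (f x)" using f by (auto simp: bounded_ops_def)
  have lg: "bounded_linear g" "\<And>c x. g (scaleZ c x) = scaleY c (g x)" using g by (auto simp: bounded_ops_def)
  have cont: "continuous_on UNIV f" "continuous_on UNIV g"
    using lf(1) lg(1) by (simp_all add: linear_continuous_on)
  have sub: "subspace {z. f z = g z}"
    unfolding subspace_def
    using lf lg by (auto simp: linear_simps)
  have "span S \<subseteq> {z. f z = g z}"
    by (rule span_minimal) (use eq sub in auto)
  moreover have "closed {z. f z = g z}"
    using cont by (rule closed_Collect_eq)
  ultimately have "UNIV \<subseteq> {z. f z = g z}"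
    using D closure_minimal by metis
  then show ?thesis by auto
qed

lemma lp_basis_norm:
  assumes "1 \<le> p"
  shows "(lp_basis n :: nat \<Rightarrow> 'k::real_normed_field) \<in> lp p" "lp_norm p (lp_basis n :: nat \<Rightarrow> 'k) = 1"
proof -
  have *: "(\<lambda>m. norm ((lp_basis n :: nat \<Rightarrow> 'k) m) powr p) = (\<lambda>m. if m = n then 1 else 0)"
    using assms by (auto simp: lp_basis_def)
  have s: "(\<lambda>m. if m = n then 1 else 0 :: real) sums 1"
    using sums_single[of n "\<lambda>_. 1::real"] by simp
  show "(lp_basis n :: nat \<Rightarrow> 'k) \<in> lp p" "lp_norm p (lp_basis n :: nat \<Rightarrow> 'k) = 1"
    using s by (simp_all add: lp_def lp_norm_def * sums_iff)
qed

lemma norm_le_lp_norm: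
  fixes a :: "nat \<Rightarrow> 'k::real_normed_field"
  assumes "1 \<le> p" "a \<in> lp p"
  shows "norm (a n) \<le> lp_norm p a"
proof -
  have "norm (a n) powr p \<le> (\<Sum>n. norm (a n) powr p)"
    using assms sum_le_suminf[of "\<lambda>n. norm (a n) powr p" "{n}"] by (auto simp: lp_def)
  then have "(norm (a n) powr p) powr (1/p) \<le> lp_norm p a"
    unfolding lp_norm_def using assms by (intro powr_mono2) auto
  then show ?thesis using assms by (simp add: powr_powr)
qed

lemma lp_norm_mult:
  fixes a :: "nat \<Rightarrow> 'k::real_normed_field"
  assumes "1 \<le> p" "a \<in> lp p"
  shows "(\<lambda>n. c * a n) \<in> lp p" "lp_norm p (\<lambda>n. c * a n) = norm c * lp_norm p a"
proof -
  have s: "summable (\<lambda>n. norm (a n) powr p)" using assms by (simp add: lp_def)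
  have *: "norm (c * a n) powr p = norm c powr p * norm (a n) powr p" for n
    by (simp add: norm_mult powr_mult)
  show "(\<lambda>n. c * a n) \<in> lp p" using s by (simp add: lp_def * summable_mult)
  show "lp_norm p (\<lambda>n. c * a n) = norm c * lp_norm p a"
    using s assms suminf_nonneg[OF s] unfolding lp_norm_def *
    by (simp add: suminf_mult powr_mult powr_powr)
qed

lemma (in lp_tensor) Gamma_op_unique_existence:
  "\<exists>!G. G \<in> bounded_ops scaleZ scaleY \<and> (\<forall>a\<in>lp p. \<forall>y. G (tensor a y) = scaleY (a n) y)"
proof (rule ex_ex1I)
  let ?e = "lp_basis n :: nat \<Rightarrow> 'k"
  let ?L = "\<lambda>y. tensor ?e y"
  note e = lp_basis_norm[OF p_ge_1, where n = n and 'k = 'k]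
  define T where "T a = (\<lambda>m. a n * ?e m)" for a :: "nat \<Rightarrow> 'k"
  have "T \<in> lp_bounded_ops p"
    unfolding lp_bounded_ops_def
  proof (safe)
    fix a :: "nat \<Rightarrow> 'k" assume a: "a \<in> lp p"
    show "T a \<in> lp p" using lp_norm_mult(1)[OF p_ge_1 e(1)] by (simp add: T_def)
  next
    show "\<exists>C. \<forall>a\<in>lp p. lp_norm p (T a) \<le> C * lp_norm p a"
      using lp_norm_mult(2)[OF p_ge_1 e(1)] e(2) norm_le_lp_norm[OF p_ge_1]
      by (intro exI[of _ 1]) (auto simp: T_def)
  qed (auto simp: T_def algebra_simps)
  moreover have "id \<in> bounded_ops scaleY scaleY"
    by (auto simp: bounded_ops_def id_def)
  ultimately obtain W where W: "W \<in> bounded_ops scaleZ scaleZ"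
      and WT: "\<And>a y. a \<in> lp p \<Longrightarrow> W (tensor a y) = tensor (T a) y"
    using tensor_operators by fastforce
  have W': "bounded_linear W" "\<And>c z. W (scaleZ c z) = scaleZ c (W z)"
    using W by (auto simp: bounded_ops_def)
  have WT': "W (tensor a y) = ?L (scaleY (a n) y)" if "a \<in> lp p" for a y
    using WT[OF that] tensor_scale_left[OF e(1)] tensor_scale_right[OF e(1)] by (simp add: T_def)
  have nL: "norm (?L y) = norm y" for y using cross_norm[OF e(1)] e(2) by simp
  have addL: "?L (y + y') = ?L y + ?L y'" and scL: "?L (scaleY c y) = scaleZ c (?L y)" for y y' c
    using tensor_add_right[OF e(1)] tensor_scale_right[OF e(1)] by auto
  have blL: "bounded_linear ?L"
    by (rule bounded_linear_intro[where K=1])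
       (use addL scL nL Y.scale_of_real Z.scale_of_real in \<open>auto simp flip: Y.scale_of_real Z.scale_of_real\<close>)
  have "complete (range ?L)"
    by (rule complete_isometric_image[of 1]) (use blL nL in \<open>auto intro: complete_UNIV\<close>)
  then have cl: "closed (range ?L)" by (rule complete_imp_closed)
  have cl': "closed {z. W z \<in> range ?L}"
    using continuous_closed_vimage[OF cl, of W] W'(1)
    by (auto simp: vimage_def linear_continuous_at)
  have z0: "?L 0 = 0" using bounded_linear.linear[OF blL] by (rule linear_0)
  have "Z.subspace {z. W z \<in> range ?L}"
    unfolding Z.subspace_def
  proof (safe)
    show "W 0 \<in> range ?L" using z0 W'(1) by (metis linear_simps(3) rangeI)
  next
    fix x y u v assume "W x = ?L u" "W y = ?L v"
    then have "W (x + y) = ?L (u + v)" using W'(1) addL by (simp add: linear_simps)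
    then show "W (x + y) \<in> range ?L" by simp
  next
    fix c x u assume "W x = ?L u"
    then have "W (scaleZ c x) = ?L (scaleY c u)" using W'(2) scL by simp
    then show "W (scaleZ c x) \<in> range ?L" by simp
  qed
  then have "Z.span {tensor a y | a y. a \<in> lp p} \<subseteq> {z. W z \<in> range ?L}"
    by (intro Z.span_minimal) (auto simp: WT')
  then have "closure (Z.span {tensor a y | a y. a \<in> lp p}) \<subseteq> {z. W z \<in> range ?L}"
    using cl' by (rule closure_minimal)
  then have "\<forall>z. \<exists>y. W z = ?L y" using tensor_dense by auto
  then obtain G where G: "\<And>z. W z = ?L (G z)" by metis
  have inj: "x = y" if "?L x = ?L y" for x y
  proof -
    have "?L (x - y) = 0" using that blL by (simp add: linear_simps)
    then show ?thesis using nL[of "x - y"] by simp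
  qed
  obtain K where K: "\<And>z. norm (W z) \<le> norm z * K" using bounded_linear.bounded[OF W'(1)] by blast
  have Gs: "G (scaleZ c z) = scaleY c (G z)" for c z
    by (rule inj) (metis G W'(2) scL)
  have "bounded_linear G"
  proof (rule bounded_linear_intro)
    show "G (x + y) = G x + G y" for x y
      by (rule inj) (metis G W'(1) addL linear_simps(1))
    show "G (r *\<^sub>R x) = r *\<^sub>R G x" for r x
      using Gs[of "of_real r" x] by (simp add: Y.scale_of_real Z.scale_of_real)
    show "norm (G z) \<le> norm z * K" for z using K[of z] G[of z] nL by simp
  qed
  moreover have "G (tensor a y) = scaleY (a n) y" if "a \<in> lp p" for a y
    by (rule inj) (metis G WT' that)
  ultimately show "\<exists>G. G \<in> bounded_ops scaleZ scaleY \<and>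
      (\<forall>a\<in>lp p. \<forall>y. G (tensor a y) = scaleY (a n) y)"
    using Gs by (auto simp: bounded_ops_def)
next
  fix G H
  assume "G \<in> bounded_ops scaleZ scaleY \<and> (\<forall>a\<in>lp p. \<forall>y. G (tensor a y) = scaleY (a n) y)"
    and "H \<in> bounded_ops scaleZ scaleY \<and> (\<forall>a\<in>lp p. \<forall>y. H (tensor a y) = scaleY (a n) y)"
  then show "G = H"
    by (intro bounded_ops_eqI[OF Z.banach_over_axioms tensor_dense]) auto
qed

section \<open>Operator-valued p-approximate Schauder frames\<close>

definition frame_operator ::
  "(nat \<Rightarrow> 'x \<Rightarrow> 'y) \<Rightarrow> (nat \<Rightarrow> 'y \<Rightarrow> 'x) \<Rightarrow> 'x \<Rightarrow> 'x::real_normed_vector" where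
  "frame_operator A \<Psi> x = (\<Sum>n. \<Psi> n (A n x))"

definition analysis_operator ::
  "((nat \<Rightarrow> 'k::zero_neq_one) \<Rightarrow> 'y \<Rightarrow> 'z) \<Rightarrow> (nat \<Rightarrow> 'x \<Rightarrow> 'y) \<Rightarrow> 'x \<Rightarrow> 'z::real_normed_vector" where
  "analysis_operator tensor A x = (\<Sum>n. L_op tensor n (A n x))"

definition synthesis_operator ::
  "('k \<Rightarrow> 'y \<Rightarrow> 'y) \<Rightarrow> ('k \<Rightarrow> 'z \<Rightarrow> 'z) \<Rightarrow> real \<Rightarrow> ((nat \<Rightarrow> 'k::real_normed_field) \<Rightarrow> 'y \<Rightarrow> 'z) \<Rightarrow>
   (nat \<Rightarrow> 'y::real_normed_vector \<Rightarrow> 'x) \<Rightarrow> 'z::real_normed_vector \<Rightarrow> 'x::real_normed_vector" where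
  "synthesis_operator scaleY scaleZ p tensor \<Psi> z =
     (\<Sum>n. \<Psi> n (Gamma_op scaleY scaleZ p tensor n z))"

definition operator_valued_p_ASF ::
  "('k \<Rightarrow> 'x \<Rightarrow> 'x) \<Rightarrow> ('k \<Rightarrow> 'y \<Rightarrow> 'y) \<Rightarrow> ('k \<Rightarrow> 'z \<Rightarrow> 'z) \<Rightarrow> real \<Rightarrow>
   ((nat \<Rightarrow> 'k::real_normed_field) \<Rightarrow> 'y \<Rightarrow> 'z::real_normed_vector) \<Rightarrow>
   (nat \<Rightarrow> 'x::real_normed_vector \<Rightarrow> 'y::real_normed_vector) \<Rightarrow> (nat \<Rightarrow> 'y \<Rightarrow> 'x) \<Rightarrow> bool" where
  "operator_valued_p_ASF scaleX scaleY scaleZ p tensor A \<Psi> \<longleftrightarrow>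
     (\<forall>n. A n \<in> bounded_ops scaleX scaleY) \<and>
     (\<forall>n. \<Psi> n \<in> bounded_ops scaleY scaleX) \<and>
     ((\<forall>x. summable (\<lambda>n. \<Psi> n (A n x))) \<and>
      bounded_invertible scaleX (frame_operator A \<Psi>)) \<and>
     ((\<forall>x. summable (\<lambda>n. L_op tensor n (A n x))) \<and>
      analysis_operator tensor A \<in> bounded_ops scaleX scaleZ) \<and>
     ((\<forall>z. summable (\<lambda>n. \<Psi> n (Gamma_op scaleY scaleZ p tensor n z))) \<and>
      synthesis_operator scaleY scaleZ p tensor \<Psi> \<in> bounded_ops scaleZ scaleX)"

end

theory Submission
  imports Defs
begin

text \<open>Everything rests on the expansion \<open>z = (\<Sum>n. L\<^sub>n (\<Gamma>\<^sub>n z))\<close>, valid for every \<open>z\<close> in the completed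
  tensor product. Its partial sums are \<open>P\<^sub>N \<otimes> I\<close>, where \<open>P\<^sub>N\<close> keeps the first \<open>N\<close> entries of a
  sequence in \<open>\<ell>\<^sup>p\<close>. As \<open>P\<^sub>N\<close> is a contraction, so is \<open>P\<^sub>N \<otimes> I\<close>, by the operator norm
  inequality required of the tensor norm. On an elementary tensor \<open>a \<otimes> y\<close> the error is
  \<open>(a - P\<^sub>N a) \<otimes> y\<close>, whose norm tends to \<open>0\<close> as the tail of a convergent series. The uniform bound
  carries the convergence from the dense span of the elementary tensors to the whole space
  (\<open>L_Gamma_sums\<close>).

  Given a factorisation \<open>A\<^sub>n = \<Gamma>\<^sub>n U\<close>, \<open>\<Psi>\<^sub>n = V L\<^sub>n\<close>, the series of the frame, analysis and
  synthesis operators are obtained from this expansion by applying \<open>U\<close> beforehand, \<open>V\<close> afterwards,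
  or both, so that these operators are \<open>V U\<close>, \<open>U\<close> and \<open>V\<close>. Conversely, a frame factors through
  \<open>U = \<theta>\<^sub>A\<close> and \<open>V = \<theta>\<^sub>\<Psi>\<close>: the biorthogonality \<open>\<Gamma>\<^sub>n L\<^sub>m = \<delta>\<^sub>n\<^sub>m I\<close> gives \<open>\<Gamma>\<^sub>n \<theta>\<^sub>A = A\<^sub>n\<close> and
  \<open>\<theta>\<^sub>\<Psi> L\<^sub>n = \<Psi>\<^sub>n\<close>, and then \<open>\<theta>\<^sub>\<Psi> \<theta>\<^sub>A\<close> is the frame operator.\<close>

section \<open>Truncation of sequences\<close>

definition lp_take :: "nat \<Rightarrow> (nat \<Rightarrow> 'k::zero) \<Rightarrow> nat \<Rightarrow> 'k" where
  "lp_take N a = (\<lambda>m. if m < N then a m else 0)"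

definition lp_drop :: "nat \<Rightarrow> (nat \<Rightarrow> 'k::zero) \<Rightarrow> nat \<Rightarrow> 'k" where
  "lp_drop N a = (\<lambda>m. if m < N then 0 else a m)"

lemma lp_mono:
  assumes "a \<in> lp p" "0 \<le> p" "\<And>m. norm (b m) \<le> norm (a m)"
  shows "b \<in> lp p" "lp_norm p b \<le> lp_norm p a"
proof -
  have le: "norm (b m) powr p \<le> norm (a m) powr p" for m
    using assms by (intro powr_mono2) auto
  have sa: "summable (\<lambda>n. norm (a n) powr p)"
    using assms by (simp add: lp_def)
  then have sb: "summable (\<lambda>n. norm (b n) powr p)"
    by (rule summable_comparison_test'[where N = 0]) (simp add: le)
  show "b \<in> lp p" using sb by (simp add: lp_def)
  show "lp_norm p b \<le> lp_norm p a"
    unfolding lp_norm_def using assms(2) suminf_le[OF le sb sa] suminf_nonneg[OF sb]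
    by (intro powr_mono2) auto
qed

lemma lp_norm_drop_tendsto_0:
  assumes "a \<in> lp p" "0 < p"
  shows "(\<lambda>N. lp_norm p (lp_drop N a)) \<longlonglongrightarrow> 0"
proof -
  let ?f = "\<lambda>n. norm (a n) powr p"
  have s: "summable ?f" using assms by (simp add: lp_def)
  have "(\<Sum>n. norm (lp_drop N a n) powr p) = suminf ?f - sum ?f {..<N}" for N
  proof -
    have "(\<lambda>n. ?f n - (if n \<in> {..<N} then ?f n else 0)) sums (suminf ?f - sum ?f {..<N})"
      by (intro sums_diff sums_If_finite_set summable_sums s) simp
    moreover have "(\<lambda>n. norm (lp_drop N a n) powr p) = (\<lambda>n. ?f n - (if n \<in> {..<N} then ?f n else 0))"
      using assms by (auto simp: lp_drop_def)
    ultimately show ?thesis by (simp add: sums_iff)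
  qed
  moreover have lim: "(\<lambda>N. suminf ?f - sum ?f {..<N}) \<longlonglongrightarrow> 0"
    using tendsto_diff[OF tendsto_const summable_LIMSEQ[OF s], of "suminf ?f"] by simp
  moreover have "(\<lambda>N. (suminf ?f - sum ?f {..<N}) powr (1 / p)) \<longlonglongrightarrow> 0"
    using assms sum_le_suminf[OF s]
    by (intro tendsto_zero_powrI[OF lim tendsto_const]) auto
  ultimately show ?thesis by (simp add: lp_norm_def)
qed

lemma lp_take_in_lp_bounded_ops:
  assumes "1 \<le> p"
  shows "lp_take N \<in> (lp_bounded_ops p :: ((nat \<Rightarrow> 'k::real_normed_field) \<Rightarrow> _) set)"
    and "lp_onorm p (lp_take N :: (nat \<Rightarrow> 'k) \<Rightarrow> _) \<le> 1"
proof -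
  have t: "lp_take N a \<in> lp p" "lp_norm p (lp_take N a) \<le> lp_norm p a"
    if "a \<in> lp p" for a :: "nat \<Rightarrow> 'k"
    using lp_mono[OF that, of "lp_take N a"] assms by (auto simp: lp_take_def)
  show "lp_take N \<in> (lp_bounded_ops p :: ((nat \<Rightarrow> 'k) \<Rightarrow> _) set)"
    unfolding lp_bounded_ops_def using t
    by (auto simp: lp_take_def[abs_def] intro!: exI[of _ 1])
  show "lp_onorm p (lp_take N :: (nat \<Rightarrow> 'k) \<Rightarrow> _) \<le> 1"
    unfolding lp_onorm_def
  proof (rule cSUP_least)
    show "(lp p :: (nat \<Rightarrow> 'k) set) \<noteq> {}" using lp_basis_norm(1)[OF assms] by blast
    show "lp_norm p (lp_take N a) / lp_norm p a \<le> 1" if "a \<in> lp p" for a :: "nat \<Rightarrow> 'k"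
      using t[OF that] by (auto simp: divide_le_eq_1 lp_norm_def not_less less_le)
  qed
qed

section \<open>Bounded operators over the scalar field\<close>

lemma bounded_opsD:
  assumes "f \<in> bounded_ops s t"
  shows "bounded_linear f" "f (s c x) = t c (f x)"
  using assms by (auto simp: bounded_ops_def)

lemma bounded_ops_compose:
  assumes "f \<in> bounded_ops t u" "g \<in> bounded_ops s t"
  shows "(\<lambda>x. f (g x)) \<in> bounded_ops s u"
  using assms by (auto simp: bounded_ops_def intro: bounded_linear_compose)

lemma bounded_ops_sum:
  assumes "banach_over t" "\<And>i. i \<in> I \<Longrightarrow> f i \<in> bounded_ops s t"
  shows "(\<lambda>x. \<Sum>i\<in>I. f i x) \<in> bounded_ops s t"
proof -
  interpret banach_over t by fact
  show ?thesis
    using assms(2) by (auto simp: bounded_ops_def scale_sum_right intro!: bounded_linear_sum sum.cong)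
qed

text \<open>For a uniformly bounded sequence of operators the set of points at which it converges to
  the identity is closed: the distance of \<open>P n z\<close> to \<open>z\<close> is at most that of \<open>P n w\<close> to \<open>w\<close> plus
  \<open>(\<bar>C\<bar> + 1) * dist z w\<close>.\<close>

lemma tendsto_id_closure:
  fixes P :: "nat \<Rightarrow> 'z::real_normed_vector \<Rightarrow> 'z"
  assumes lin: "\<And>n. linear (P n)" and bound: "\<And>n z. norm (P n z) \<le> C * norm z"
    and conv: "\<And>w. w \<in> S \<Longrightarrow> (\<lambda>n. P n w) \<longlonglongrightarrow> w"
    and z: "z \<in> closure S"
  shows "(\<lambda>n. P n z) \<longlonglongrightarrow> z"
proof (rule LIMSEQ_I)
  fix e :: real assume e: "0 < e"
  define d where "d = e / (2 * (\<bar>C\<bar> + 1))"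
  have d: "0 < d" "(\<bar>C\<bar> + 1) * d = e / 2" using e by (auto simp: d_def field_simps)
  obtain w where w: "w \<in> S" "dist w z < d" using z d(1) closure_approachable by blast
  obtain M where M: "\<And>n. n \<ge> M \<Longrightarrow> norm (P n w - w) < e / 2"
    using LIMSEQ_D[OF conv[OF w(1)], of "e/2"] e by auto
  have "norm (P n z - z) < e" if "n \<ge> M" for n
  proof -
    have "P n z - z = (P n w - w) + (P n (z - w) + (w - z))"
      by (simp add: linear_diff[OF lin])
    then have "norm (P n z - z) \<le> norm (P n w - w) + (norm (P n (z - w)) + norm (w - z))"
      by (simp only:) (intro norm_triangle_mono order_refl norm_triangle_ineq)
    also have "norm (P n (z - w)) \<le> \<bar>C\<bar> * norm (w - z)"
      using bound[of n "z - w"] by (smt (verit) mult_right_mono norm_ge_zero norm_minus_commute)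
    also have "norm (P n w - w) + (\<bar>C\<bar> * norm (w - z) + norm (w - z))
        = norm (P n w - w) + (\<bar>C\<bar> + 1) * norm (w - z)"
      by (simp add: algebra_simps)
    also have "(\<bar>C\<bar> + 1) * norm (w - z) \<le> (\<bar>C\<bar> + 1) * d"
      using w(2) by (intro mult_left_mono) (auto simp: dist_norm)
    also have "norm (P n w - w) + (\<bar>C\<bar> + 1) * d < e" using M[OF that] d(2) by simp
    finally show ?thesis by simp
  qed
  then show "\<exists>no. \<forall>n\<ge>no. norm (P n z - z) < e" by blast
qed

section \<open>The coordinate expansion in the completed tensor product\<close>

context lp_tensor
begin

abbreviation L :: "nat \<Rightarrow> 'y \<Rightarrow> 'z" where
  "L \<equiv> L_op tensor"

abbreviation \<Gamma> :: "nat \<Rightarrow> 'z \<Rightarrow> 'y" where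
  "\<Gamma> \<equiv> Gamma_op scaleY scaleZ p tensor"

lemma Gamma_in_bounded_ops: "\<Gamma> n \<in> bounded_ops scaleZ scaleY"
  and Gamma_tensor: "a \<in> lp p \<Longrightarrow> \<Gamma> n (tensor a y) = scaleY (a n) y"
  using theI'[OF Gamma_op_unique_existence[of n]] unfolding Gamma_op_def by auto

lemma L_in_bounded_ops: "L n \<in> bounded_ops scaleY scaleZ"
proof -
  note e = lp_basis_norm[OF p_ge_1, where n = n and 'k = 'k]
  have sc: "L n (scaleY c y) = scaleZ c (L n y)" for c y
    by (simp add: L_op_def tensor_scale_right e)
  have "bounded_linear (L n)"
  proof (rule bounded_linear_intro[where K = 1])
    show "L n (x + y) = L n x + L n y" for x y by (simp add: L_op_def tensor_add_right e)
    show "L n (r *\<^sub>R y) = r *\<^sub>R L n y" for r y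
      using sc[of "of_real r" y] by (simp add: Y.scale_of_real Z.scale_of_real)
    show "norm (L n y) \<le> norm y * 1" for y by (simp add: L_op_def cross_norm e)
  qed
  with sc show ?thesis by (simp add: bounded_ops_def)
qed

lemma Gamma_L: "\<Gamma> n (L m y) = (if n = m then y else 0)"
  using Gamma_tensor[OF lp_basis_norm(1)[OF p_ge_1], of n m y]
  by (simp add: L_op_def lp_basis_def)

text \<open>Moving a scalar across the tensor sign turns \<open>(a\<^sub>n e\<^sub>n) \<otimes> y\<close> into
  \<open>e\<^sub>n \<otimes> (a\<^sub>n y) = L\<^sub>n (\<Gamma>\<^sub>n (a \<otimes> y))\<close>, and the truncation of \<open>a\<close> is a finite sum of the \<open>a\<^sub>n e\<^sub>n\<close>.\<close>

lemma tensor_lp_take: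
  assumes a: "a \<in> lp p"
  shows "tensor (lp_take N a) y = (\<Sum>n<N. L n (\<Gamma> n (tensor a y)))"
proof (induction N)
  case 0
  show ?case
    using tensor_scale_left[OF a, of 0 y] by (simp add: lp_take_def)
next
  case (Suc N)
  note e = lp_basis_norm(1)[OF p_ge_1, where n = N and 'k = 'k]
  have "lp_take (Suc N) a = (\<lambda>m. lp_take N a m + a N * lp_basis N m)"
    by (auto simp: lp_take_def lp_basis_def less_Suc_eq)
  moreover have "lp_take N a \<in> lp p"
    using lp_mono(1)[OF a, of "lp_take N a"] p_ge_1 by (simp add: lp_take_def)
  ultimately have "tensor (lp_take (Suc N) a) y = tensor (lp_take N a) y + scaleZ (a N) (L N y)"
    by (simp add: tensor_add_left tensor_scale_left e lp_norm_mult(1)[OF p_ge_1 e] L_op_def)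
  also have "scaleZ (a N) (L N y) = L N (\<Gamma> N (tensor a y))"
    by (simp add: Gamma_tensor a L_op_def tensor_scale_right e)
  finally show ?case using Suc by simp
qed

lemma partial_sum_in_bounded_ops: "(\<lambda>z. \<Sum>n<N. L n (\<Gamma> n z)) \<in> bounded_ops scaleZ scaleZ"
  by (intro bounded_ops_sum[OF Z.banach_over_axioms]
        bounded_ops_compose[OF L_in_bounded_ops Gamma_in_bounded_ops])

text \<open>The partial sum is the extension of (truncation) \<open>\<otimes>\<close> (identity), since the two bounded
  operators agree on elementary tensors; truncation and the identity both have norm at most \<open>1\<close>.\<close>

lemma norm_partial_sum_le: "norm (\<Sum>n<N. L n (\<Gamma> n z)) \<le> norm z"
proof -
  have "id \<in> bounded_ops scaleY scaleY" by (auto simp: bounded_ops_def id_def)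
  then obtain W where W: "W \<in> bounded_ops scaleZ scaleZ"
    and Wt: "\<And>a y. a \<in> lp p \<Longrightarrow> W (tensor a y) = tensor (lp_take N a) (id y)"
    and nW: "onorm W \<le> lp_onorm p (lp_take N :: (nat \<Rightarrow> 'k) \<Rightarrow> _) * onorm (id :: 'y \<Rightarrow> 'y)"
    using tensor_operators[OF lp_take_in_lp_bounded_ops(1)[OF p_ge_1]] by blast
  have "W = (\<lambda>z. \<Sum>n<N. L n (\<Gamma> n z))"
    by (rule bounded_ops_eqI[OF Z.banach_over_axioms tensor_dense W partial_sum_in_bounded_ops])
       (auto simp: Wt tensor_lp_take)
  moreover have "onorm W \<le> 1"
  proof -
    have "onorm (id :: 'y \<Rightarrow> 'y) \<le> 1" "0 \<le> onorm (id :: 'y \<Rightarrow> 'y)"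
      using onorm_id_le onorm_pos_le[OF bounded_linear_ident] by (auto simp: id_def)
    then have "lp_onorm p (lp_take N :: (nat \<Rightarrow> 'k) \<Rightarrow> _) * onorm (id :: 'y \<Rightarrow> 'y) \<le> 1"
      using mult_right_mono[OF lp_take_in_lp_bounded_ops(2)[OF p_ge_1, of N, where 'k = 'k]]
      by fastforce
    with nW show ?thesis by linarith
  qed
  moreover have "norm (W z) \<le> onorm W * norm z"
    using onorm[OF bounded_opsD(1)[OF W]] .
  ultimately show ?thesis
    using mult_right_mono[of "onorm W" 1 "norm z"] by simp
qed

lemma tensor_expansion:
  assumes a: "a \<in> lp p"
  shows "(\<lambda>N. \<Sum>n<N. L n (\<Gamma> n (tensor a y))) \<longlonglongrightarrow> tensor a y"
proof -
  have mem: "lp_take N a \<in> lp p" "lp_drop N a \<in> lp p" for N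
    using lp_mono(1)[OF a, of "lp_take N a"] lp_mono(1)[OF a, of "lp_drop N a"] p_ge_1
    by (auto simp: lp_take_def lp_drop_def)
  have "a = (\<lambda>m. lp_take N a m + lp_drop N a m)" for N
    by (auto simp: lp_take_def lp_drop_def)
  then have split: "tensor a y = tensor (lp_take N a) y + tensor (lp_drop N a) y" for N
    using tensor_add_left[OF mem] by metis
  have "norm (tensor (lp_take N a) y - tensor a y) = lp_norm p (lp_drop N a) * norm y" for N
    by (simp add: split[of N] cross_norm mem)
  moreover have "(\<lambda>N. lp_norm p (lp_drop N a) * norm y) \<longlonglongrightarrow> 0"
    using lp_norm_drop_tendsto_0[OF a] p_ge_1 by (intro tendsto_mult_left_zero) auto
  ultimately show ?thesis
    unfolding tensor_lp_take[OF a, symmetric]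
    by (subst LIM_zero_iff[symmetric], subst tendsto_norm_zero_iff[symmetric]) simp
qed

lemma L_Gamma_sums: "(\<lambda>n. L n (\<Gamma> n z)) sums z"
proof -
  let ?P = "\<lambda>N z. \<Sum>n<N. L n (\<Gamma> n z)"
  let ?C = "{z. (\<lambda>N. ?P N z) \<longlonglongrightarrow> z}"
  note P = bounded_opsD[OF partial_sum_in_bounded_ops]
  have scale_limit: "(\<lambda>N. scaleZ c (f N)) \<longlonglongrightarrow> scaleZ c l" if "f \<longlonglongrightarrow> l" for c f l
  proof -
    have "norm (scaleZ c (f N) - scaleZ c l) = norm c * norm (f N - l)" for N
      by (simp add: Z.norm_scale flip: Z.scale_right_diff_distrib)
    moreover have "(\<lambda>N. norm c * norm (f N - l)) \<longlonglongrightarrow> 0"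
      using that by (intro tendsto_mult_right_zero tendsto_norm_zero) (simp add: LIM_zero)
    ultimately show ?thesis
      by (subst LIM_zero_iff[symmetric], subst tendsto_norm_zero_iff[symmetric]) simp
  qed
  have "Z.subspace ?C"
    unfolding Z.subspace_def
  proof safe
    show "(\<lambda>N. ?P N 0) \<longlonglongrightarrow> 0"
      using linear_0[OF bounded_linear.linear[OF P(1)]] by simp
    show "(\<lambda>N. ?P N (x + y)) \<longlonglongrightarrow> x + y"
      if "(\<lambda>N. ?P N x) \<longlonglongrightarrow> x" "(\<lambda>N. ?P N y) \<longlonglongrightarrow> y" for x y
      using tendsto_add[OF that] linear_add[OF bounded_linear.linear[OF P(1)]] by simp
    show "(\<lambda>N. ?P N (scaleZ c x)) \<longlonglongrightarrow> scaleZ c x" if "(\<lambda>N. ?P N x) \<longlonglongrightarrow> x" for c x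
      using scale_limit[OF that] by (simp only: P(2))
  qed
  then have span: "Z.span {tensor a y | a y. a \<in> lp p} \<subseteq> ?C"
    by (intro Z.span_minimal) (auto intro: tensor_expansion)
  show ?thesis
    unfolding sums_def
  proof (rule tendsto_id_closure)
    show "linear (?P N)" for N using bounded_linear.linear[OF P(1)] .
    show "norm (?P N z) \<le> 1 * norm z" for N z using norm_partial_sum_le by simp
    show "(\<lambda>N. ?P N w) \<longlonglongrightarrow> w" if "w \<in> Z.span {tensor a y | a y. a \<in> lp p}" for w
      using span that by blast
    show "z \<in> closure (Z.span {tensor a y | a y. a \<in> lp p})" using tensor_dense by simp
  qed
qed

section \<open>Frames and factorisations\<close>

text \<open>By biorthogonality, applying \<open>\<Gamma>\<^sub>n\<close> to the series of \<open>\<theta>\<^sub>A x\<close>, or \<open>\<theta>\<^sub>\<Psi>\<close> to \<open>L\<^sub>n y\<close>, leaves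
  only the \<open>n\<close>-th term.\<close>

lemma ASF_imp_factorisation:
  assumes ASF: "operator_valued_p_ASF scaleX scaleY scaleZ p tensor A \<Psi>"
  defines "U \<equiv> analysis_operator tensor A"
    and "V \<equiv> synthesis_operator scaleY scaleZ p tensor \<Psi>"
  shows "\<Gamma> n \<circ> U = A n" "V \<circ> L n = \<Psi> n" "V \<circ> U = frame_operator A \<Psi>"
proof -
  have sU: "summable (\<lambda>n. L n (A n x))" and bP: "\<Psi> n \<in> bounded_ops scaleY scaleX" for x n
    using ASF by (auto simp: operator_valued_p_ASF_def)
  have GU: "\<Gamma> n (U x) = A n x" for n x
  proof -
    have "(\<lambda>m. \<Gamma> n (L m (A m x))) sums \<Gamma> n (U x)"
      using bounded_linear.sums[OF bounded_opsD(1)[OF Gamma_in_bounded_ops] summable_sums[OF sU]]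
      unfolding U_def analysis_operator_def .
    moreover have "(\<lambda>m. \<Gamma> n (L m (A m x))) = (\<lambda>m. if m = n then A m x else 0)"
      by (auto simp: Gamma_L)
    ultimately show ?thesis using sums_single[of n "\<lambda>m. A m x"] sums_unique2 by metis
  qed
  show "\<Gamma> n \<circ> U = A n" using GU by auto
  show "V \<circ> L n = \<Psi> n"
  proof
    fix y
    have "\<Psi> m 0 = 0" for m using bounded_opsD(1)[OF bP] by (simp add: linear_simps)
    then have "(\<lambda>m. \<Psi> m (\<Gamma> m (L n y))) = (\<lambda>m. if m = n then \<Psi> m y else 0)"
      by (auto simp: Gamma_L)
    then show "(V \<circ> L n) y = \<Psi> n y"
      using sums_single[of n "\<lambda>m. \<Psi> m y"]
      by (simp add: V_def synthesis_operator_def sums_iff)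
  qed
  show "V \<circ> U = frame_operator A \<Psi>"
    by (auto simp: V_def synthesis_operator_def frame_operator_def GU)
qed

end

theorem theorem2p9:
  fixes scaleX :: "'k::real_or_complex \<Rightarrow> 'x::banach \<Rightarrow> 'x"
    and scaleY :: "'k \<Rightarrow> 'y::banach \<Rightarrow> 'y"
    and scaleZ :: "'k \<Rightarrow> 'z::banach \<Rightarrow> 'z"
    and p :: real
    and tensor :: "(nat \<Rightarrow> 'k) \<Rightarrow> 'y \<Rightarrow> 'z"
    and A :: "nat \<Rightarrow> 'x \<Rightarrow> 'y"
    and \<Psi> :: "nat \<Rightarrow> 'y \<Rightarrow> 'x"
  assumes "banach_over scaleX" and "banach_over scaleY" and "1 \<le> p"
    and "lp_tensor scaleY scaleZ p tensor"
    and "\<And>n. A n \<in> bounded_ops scaleX scaleY"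
    and "\<And>n. \<Psi> n \<in> bounded_ops scaleY scaleX"
  shows "operator_valued_p_ASF scaleX scaleY scaleZ p tensor A \<Psi> \<longleftrightarrow>
    (\<exists>U \<in> bounded_ops scaleX scaleZ. \<exists>V \<in> bounded_ops scaleZ scaleX.
       (\<forall>n. A n = Gamma_op scaleY scaleZ p tensor n \<circ> U \<and> \<Psi> n = V \<circ> L_op tensor n) \<and>
       bounded_invertible scaleX (V \<circ> U))"
proof -
  interpret lp_tensor scaleY scaleZ p tensor by fact
  show ?thesis
  proof
    assume ASF: "operator_valued_p_ASF scaleX scaleY scaleZ p tensor A \<Psi>"
    then have "analysis_operator tensor A \<in> bounded_ops scaleX scaleZ"
      "synthesis_operator scaleY scaleZ p tensor \<Psi> \<in> bounded_ops scaleZ scaleX"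
      "bounded_invertible scaleX (frame_operator A \<Psi>)"
      by (auto simp: operator_valued_p_ASF_def)
    with ASF_imp_factorisation[OF ASF]
    show "\<exists>U \<in> bounded_ops scaleX scaleZ. \<exists>V \<in> bounded_ops scaleZ scaleX.
       (\<forall>n. A n = \<Gamma> n \<circ> U \<and> \<Psi> n = V \<circ> L n) \<and> bounded_invertible scaleX (V \<circ> U)"
      by metis
  next
    assume "\<exists>U \<in> bounded_ops scaleX scaleZ. \<exists>V \<in> bounded_ops scaleZ scaleX.
       (\<forall>n. A n = \<Gamma> n \<circ> U \<and> \<Psi> n = V \<circ> L n) \<and> bounded_invertible scaleX (V \<circ> U)"
    then obtain U V where U: "U \<in> bounded_ops scaleX scaleZ" and V: "V \<in> bounded_ops scaleZ scaleX"
      and A: "A n = \<Gamma> n \<circ> U" and \<Psi>: "\<Psi> n = V \<circ> L n"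
      and inv: "bounded_invertible scaleX (V \<circ> U)" for n
      by blast
    note VLG = bounded_linear.sums[OF bounded_opsD(1)[OF V] L_Gamma_sums]
    have frame: "(\<lambda>n. \<Psi> n (A n x)) sums (V \<circ> U) x" for x
      using VLG[of "U x"] by (simp add: A \<Psi>)
    have analysis: "(\<lambda>n. L n (A n x)) sums U x" for x
      using L_Gamma_sums[of "U x"] by (simp add: A)
    have synthesis: "(\<lambda>n. \<Psi> n (\<Gamma> n z)) sums V z" for z
      using VLG[of z] by (simp add: \<Psi>)
    have "frame_operator A \<Psi> = V \<circ> U" "analysis_operator tensor A = U"
      "synthesis_operator scaleY scaleZ p tensor \<Psi> = V"
      using frame analysis synthesis
      by (auto simp: frame_operator_def analysis_operator_def synthesis_operator_def sums_iff)
    then show "operator_valued_p_ASF scaleX scaleY scaleZ p tensor A \<Psi>"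
      unfolding operator_valued_p_ASF_def
      using assms(5,6) inv U V frame analysis synthesis
      by (simp add: sums_iff)
  qed
qed

end
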